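(* Let $\mathcal{P}=(P,\{\,,\,\})$, $P=P_0\ltimes P_1$, be an admissible Poisson algebra whose corresponding Poisson triple is of the form $([\,,\,]_1=0,\mathcal{D},\mathcal{K})$. Then $\mathcal{P}$ is isomorphic to an admissible Poisson algebra associated to a Poisson module by means of a gauge transformation of the form $$\phi(f\oplus\eta)=f\oplus(\phi_{10}f+\eta),\qquad\phi_{10}\in\mathrm{Der}(P_0;P_1),$$ if and only if the $d_{\mathcal{D}}$-cohomology class of the 2-cocycle $\Delta\mathcal{K}\in\mathfrak{X}^2$ is trivial.
   Context: Let $R$ be a commutative ring with unit, $\mathcal{P}_0=(P_0,\cdot,\{\,,\,\}_0)$ a Poisson $R$-algebra (commutative associative unital $R$-algebra with an $R$-bilinear Lie bracket that is a derivation in each argument), $P_1$ a faithful $P_0$-module, and $P=P_0\ltimes P_1$ the $R$-module $P_0\oplus P_1$ with product $(f\oplus\eta)(g\oplus\xi)=fg\oplus(f\xi+g\eta)$. An admissible Poisson structure on $P$ is a Poisson structure with $\mathrm{pr}_0\{f\oplus\eta,g\oplus\xi\}=\{f,g\}_0$; $(P,\{\,,\,\})$ is then an admissible Poisson algebra. $\Omega^1_{P_0}$ is the module of Kähler differentials of $P_0$ over $R$ with universal derivation $d$, anchor $\varrho_{P_0}(dh)=\{h,\cdot\}_0$ (extended $P_0$-linearly). A contravariant derivative on $P_1$ is an $R$-bilinear map $\mathcal{D}:\Omega^1_{P_0}\times P_1\to P_1$ with $\mathcal{D}_{f\alpha}\eta=f\mathcal{D}_\alpha\eta$, $\mathcal{D}_\alpha(f\eta)=f\mathcal{D}_\alpha\eta+\varrho_{P_0}(\alpha)(f)\eta$.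 Every admissible Poisson algebra has a unique corresponding Poisson triple $([\,,\,]_1,\mathcal{D},\mathcal{K})$, where $[\,,\,]_1$ is a $P_0$-linear Lie bracket on $P_1$, $\mathcal{D}$ a contravariant derivative on $P_1$, and $\mathcal{K}:\Omega^1_{P_0}\times\Omega^1_{P_0}\to P_1$ a $P_0$-bilinear skew-symmetric map, such that $\{f\oplus\eta,g\oplus\xi\}=\{f,g\}_0\oplus(\mathcal{D}_{df}\xi-\mathcal{D}_{dg}\eta+[\eta,\xi]_1+\mathcal{K}(df,dg))$. $\mathrm{Der}(P_0;P_1)$ is the module of $R$-linear $D:P_0\to P_1$ with $D(fg)=fDg+gDf$. $\mathfrak{X}^k$ is the module of $R$-multilinear skew-symmetric maps $P_0^k\to P_1$ that are derivations in each argument, with differential $(d_{\mathcal{D}}Q)(f_0,\dots,f_k)=\sum_i(-1)^i\mathcal{D}_{df_i}(Q(\dots,\widehat{f_i},\dots))+\sum_{i<j}(-1)^{i+j}Q(\{f_i,f_j\}_0,f_0,\dots,\widehat{f_i},\dots,\widehat{f_j},\dots,f_k)$; when $[\,,\,]_1=0$, $\mathcal{D}$ is flat and $d_{\mathcal{D}}^2=0$. $(\Delta\mathcal{K})(f,g)=\mathcal{K}(df,dg)$, a 2-cocycle. A Poisson module over $\mathcal{P}_0$ is a pair $(P_1,\lambda)$, with $P_1$ a $P_0$-module and $\lambda:P_0\times P_1\to P_1$ an $R$-bilinear map satisfying $\lambda(f,g\eta)=g\lambda(f,\eta)+\{f,g\}_0\eta$, $\lambda(fg,\eta)=f\lambda(g,\eta)+g\lambda(f,\eta)$,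 $\lambda(\{f,g\}_0,\eta)=\lambda(f,\lambda(g,\eta))-\lambda(g,\lambda(f,\eta))$. The admissible Poisson algebra associated to $(P_1,\lambda)$ is $(P,\{\,,\,\}_\lambda)$ with $\{f\oplus\eta,g\oplus\xi\}_\lambda=\{f,g\}_0\oplus(\lambda(f,\xi)-\lambda(g,\eta))$. Isomorphic by means of $\phi$ means $\phi$ is a Poisson algebra isomorphism between the two (same underlying commutative algebra $P$). *)

theory Defs
  imports "HOL-Algebra.Module" "HOL-Algebra.QuotRing"
begin

section \<open>Linear maps and brackets\<close>

definition linear_map ::
  "('s, 'q) ring_scheme \<Rightarrow> ('s, 'm, 'x) module_scheme \<Rightarrow> ('s, 'n, 'y) module_scheme \<Rightarrow> ('m \<Rightarrow> 'n) \<Rightarrow> bool"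
where
  "linear_map S M N h \<longleftrightarrow>
     h \<in> carrier M \<rightarrow> carrier N \<and>
     (\<forall>x\<in>carrier M. \<forall>y\<in>carrier M. h (x \<oplus>\<^bsub>M\<^esub> y) = h x \<oplus>\<^bsub>N\<^esub> h y) \<and>
     (\<forall>s\<in>carrier S. \<forall>x\<in>carrier M. h (s \<odot>\<^bsub>M\<^esub> x) = s \<odot>\<^bsub>N\<^esub> h x)"

definition bilinear_map ::
  "('s, 'q) ring_scheme \<Rightarrow> ('s, 'l, 'w) module_scheme \<Rightarrow> ('s, 'm, 'x) module_scheme \<Rightarrow>
   ('s, 'n, 'y) module_scheme \<Rightarrow> ('l \<Rightarrow> 'm \<Rightarrow> 'n) \<Rightarrow> bool"
where
  "bilinear_map S L M N b \<longleftrightarrow>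
     (\<forall>x\<in>carrier L. linear_map S M N (b x)) \<and>
     (\<forall>y\<in>carrier M. linear_map S L N (\<lambda>x. b x y))"

definition lie_bracket ::
  "('s, 'q) ring_scheme \<Rightarrow> ('s, 'm, 'x) module_scheme \<Rightarrow> ('m \<Rightarrow> 'm \<Rightarrow> 'm) \<Rightarrow> bool"
where
  "lie_bracket S M br \<longleftrightarrow>
     bilinear_map S M M M br \<and>
     (\<forall>x\<in>carrier M. br x x = \<zero>\<^bsub>M\<^esub>) \<and>
     (\<forall>x\<in>carrier M. \<forall>y\<in>carrier M. \<forall>z\<in>carrier M.
        br x (br y z) \<oplus>\<^bsub>M\<^esub> br y (br z x) \<oplus>\<^bsub>M\<^esub> br z (br x y) = \<zero>\<^bsub>M\<^esub>)"

definition poisson_algebra ::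
  "('r, 'q) ring_scheme \<Rightarrow> ('r, 'a, 'x) module_scheme \<Rightarrow> ('a \<Rightarrow> 'a \<Rightarrow> 'a) \<Rightarrow> bool"
where
  "poisson_algebra R A br \<longleftrightarrow>
     algebra R A \<and> lie_bracket R A br \<and>
     (\<forall>f\<in>carrier A. \<forall>g\<in>carrier A. \<forall>h\<in>carrier A.
        br f (g \<otimes>\<^bsub>A\<^esub> h) = br f g \<otimes>\<^bsub>A\<^esub> h \<oplus>\<^bsub>A\<^esub> g \<otimes>\<^bsub>A\<^esub> br f h) \<and>
     (\<forall>f\<in>carrier A. \<forall>g\<in>carrier A. \<forall>h\<in>carrier A.
        br (f \<otimes>\<^bsub>A\<^esub> g) h = f \<otimes>\<^bsub>A\<^esub> br g h \<oplus>\<^bsub>A\<^esub> g \<otimes>\<^bsub>A\<^esub> br f h)"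

definition poisson_algebra_iso ::
  "('r, 'q) ring_scheme \<Rightarrow> ('r, 'a, 'x) module_scheme \<Rightarrow> ('a \<Rightarrow> 'a \<Rightarrow> 'a) \<Rightarrow>
   ('r, 'b, 'y) module_scheme \<Rightarrow> ('b \<Rightarrow> 'b \<Rightarrow> 'b) \<Rightarrow> ('a \<Rightarrow> 'b) \<Rightarrow> bool"
where
  "poisson_algebra_iso R A brA B brB \<phi> \<longleftrightarrow>
     \<phi> \<in> ring_iso A B \<and> linear_map R A B \<phi> \<and>
     (\<forall>x\<in>carrier A. \<forall>y\<in>carrier A. \<phi> (brA x y) = brB (\<phi> x) (\<phi> y))"


section \<open>Modules over an algebra\<close>

definition faithful_module :: "('a, 'q) ring_scheme \<Rightarrow> ('a, 'm, 'x) module_scheme \<Rightarrow> bool"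
where
  "faithful_module A M \<longleftrightarrow>
     module A M \<and>
     (\<forall>f\<in>carrier A. (\<forall>\<eta>\<in>carrier M. f \<odot>\<^bsub>M\<^esub> \<eta> = \<zero>\<^bsub>M\<^esub>) \<longrightarrow> f = \<zero>\<^bsub>A\<^esub>)"

text \<open>A module over an \<open>R\<close>-algebra \<open>A\<close>, seen as an \<open>R\<close>-module through \<open>R \<rightarrow> A\<close>, \<open>r \<mapsto> r\<cdot>1\<close>.
  Only the additive structure and the scalar multiplication are meaningful in the result.\<close>

definition restrict_scalars ::
  "('r, 'a, 'x) module_scheme \<Rightarrow> ('a, 'm, 'y) module_scheme \<Rightarrow> ('r, 'm) module"
where
  "restrict_scalars A M =
     \<lparr>carrier = carrier M, mult = undefined, one = undefined, zero = \<zero>\<^bsub>M\<^esub>, add = (\<oplus>\<^bsub>M\<^esub>),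
      smult = (\<lambda>r x. (r \<odot>\<^bsub>A\<^esub> \<one>\<^bsub>A\<^esub>) \<odot>\<^bsub>M\<^esub> x)\<rparr>"

definition semidirect ::
  "('r, 'a, 'x) module_scheme \<Rightarrow> ('a, 'm, 'y) module_scheme \<Rightarrow> ('r, 'a \<times> 'm) module"
where
  "semidirect A M =
     \<lparr>carrier = carrier A \<times> carrier M,
      mult = (\<lambda>(f, \<eta>) (g, \<xi>). (f \<otimes>\<^bsub>A\<^esub> g, f \<odot>\<^bsub>M\<^esub> \<xi> \<oplus>\<^bsub>M\<^esub> g \<odot>\<^bsub>M\<^esub> \<eta>)),
      one = (\<one>\<^bsub>A\<^esub>, \<zero>\<^bsub>M\<^esub>),
      zero = (\<zero>\<^bsub>A\<^esub>, \<zero>\<^bsub>M\<^esub>),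
      add = (\<lambda>(f, \<eta>) (g, \<xi>). (f \<oplus>\<^bsub>A\<^esub> g, \<eta> \<oplus>\<^bsub>M\<^esub> \<xi>)),
      smult = (\<lambda>r (f, \<eta>). (r \<odot>\<^bsub>A\<^esub> f, r \<odot>\<^bsub>restrict_scalars A M\<^esub> \<eta>))\<rparr>"

definition admissible_poisson ::
  "('r, 'q) ring_scheme \<Rightarrow> ('r, 'a, 'x) module_scheme \<Rightarrow> ('a \<Rightarrow> 'a \<Rightarrow> 'a) \<Rightarrow>
   ('a, 'm, 'y) module_scheme \<Rightarrow> ('a \<times> 'm \<Rightarrow> 'a \<times> 'm \<Rightarrow> 'a \<times> 'm) \<Rightarrow> bool"
where
  "admissible_poisson R A br\<^sub>0 M br \<longleftrightarrow>
     poisson_algebra R (semidirect A M) br \<and>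
     (\<forall>x\<in>carrier (semidirect A M). \<forall>y\<in>carrier (semidirect A M).
        fst (br x y) = br\<^sub>0 (fst x) (fst y))"

definition Der ::
  "('r, 'q) ring_scheme \<Rightarrow> ('r, 'a, 'x) module_scheme \<Rightarrow> ('a, 'm, 'y) module_scheme \<Rightarrow> ('a \<Rightarrow> 'm) set"
where
  "Der R A M =
     {X \<in> carrier A \<rightarrow>\<^sub>E carrier M.
        linear_map R A (restrict_scalars A M) X \<and>
        (\<forall>f\<in>carrier A. \<forall>g\<in>carrier A.
           X (f \<otimes>\<^bsub>A\<^esub> g) = f \<odot>\<^bsub>M\<^esub> X g \<oplus>\<^bsub>M\<^esub> g \<odot>\<^bsub>M\<^esub> X f)}"


section \<open>Kaehler differentials\<close>

text \<open>\<open>\<Omega>\<^sup>1\<close> is the free \<open>A\<close>-module on the symbols \<open>df\<close>, \<open>f \<in> A\<close>, modulo the submodule generated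
  by the relations making \<open>d\<close> an \<open>R\<close>-linear derivation; its elements are additive cosets. The
  ring multiplication and unit of these records carry no meaning.\<close>

definition free_module :: "('r, 'a, 'x) module_scheme \<Rightarrow> ('a, 'a \<Rightarrow> 'a) module"
where
  "free_module A =
     \<lparr>carrier = {c \<in> carrier A \<rightarrow>\<^sub>E carrier A. finite {h \<in> carrier A. c h \<noteq> \<zero>\<^bsub>A\<^esub>}},
      mult = undefined, one = undefined,
      zero = (\<lambda>h\<in>carrier A. \<zero>\<^bsub>A\<^esub>),
      add = (\<lambda>b c. \<lambda>h\<in>carrier A. b h \<oplus>\<^bsub>A\<^esub> c h),
      smult = (\<lambda>a c. \<lambda>h\<in>carrier A. a \<otimes>\<^bsub>A\<^esub> c h)\<rparr>"

definition free_gen :: "('r, 'a, 'x) module_scheme \<Rightarrow> 'a \<Rightarrow> 'a \<Rightarrow> 'a"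
where
  "free_gen A f = (\<lambda>h\<in>carrier A. if h = f then \<one>\<^bsub>A\<^esub> else \<zero>\<^bsub>A\<^esub>)"

definition kaehler_relations ::
  "('r, 'q) ring_scheme \<Rightarrow> ('r, 'a, 'x) module_scheme \<Rightarrow> ('a \<Rightarrow> 'a) set"
where
  "kaehler_relations R A =
     {free_gen A (f \<oplus>\<^bsub>A\<^esub> g) \<ominus>\<^bsub>free_module A\<^esub> (free_gen A f \<oplus>\<^bsub>free_module A\<^esub> free_gen A g)
       | f g. f \<in> carrier A \<and> g \<in> carrier A} \<union>
     {free_gen A (r \<odot>\<^bsub>A\<^esub> f) \<ominus>\<^bsub>free_module A\<^esub> ((r \<odot>\<^bsub>A\<^esub> \<one>\<^bsub>A\<^esub>) \<odot>\<^bsub>free_module A\<^esub> free_gen A f)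
       | r f. r \<in> carrier R \<and> f \<in> carrier A} \<union>
     {free_gen A (f \<otimes>\<^bsub>A\<^esub> g) \<ominus>\<^bsub>free_module A\<^esub>
        (f \<odot>\<^bsub>free_module A\<^esub> free_gen A g \<oplus>\<^bsub>free_module A\<^esub> g \<odot>\<^bsub>free_module A\<^esub> free_gen A f)
       | f g. f \<in> carrier A \<and> g \<in> carrier A}"

definition kaehler_submodule ::
  "('r, 'q) ring_scheme \<Rightarrow> ('r, 'a, 'x) module_scheme \<Rightarrow> ('a \<Rightarrow> 'a) set"
where
  "kaehler_submodule R A =
     \<Inter>{N. submodule N A (free_module A) \<and> kaehler_relations R A \<subseteq> N}"

definition kaehler ::
  "('r, 'q) ring_scheme \<Rightarrow> ('r, 'a, 'x) module_scheme \<Rightarrow> ('a, ('a \<Rightarrow> 'a) set) module"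
where
  "kaehler R A =
     \<lparr>carrier = a_rcosets\<^bsub>free_module A\<^esub> kaehler_submodule R A,
      mult = undefined, one = undefined,
      zero = kaehler_submodule R A,
      add = (<+>\<^bsub>free_module A\<^esub>),
      smult = (\<lambda>a \<alpha>. \<Union>c\<in>\<alpha>. kaehler_submodule R A +>\<^bsub>free_module A\<^esub> (a \<odot>\<^bsub>free_module A\<^esub> c))\<rparr>"

definition kaehler_d ::
  "('r, 'q) ring_scheme \<Rightarrow> ('r, 'a, 'x) module_scheme \<Rightarrow> 'a \<Rightarrow> ('a \<Rightarrow> 'a) set"
where
  "kaehler_d R A f = kaehler_submodule R A +>\<^bsub>free_module A\<^esub> free_gen A f"

text \<open>The anchor sends the class of \<open>\<Sum> c\<^sub>h dh\<close> to \<open>\<Sum> c\<^sub>h {h, \<cdot>}\<close>; this does not depend on the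
  representative \<open>c\<close>, because \<open>{\<cdot>, f}\<close> is an \<open>R\<close>-linear derivation.\<close>

definition anchor ::
  "('r, 'a, 'x) module_scheme \<Rightarrow> ('a \<Rightarrow> 'a \<Rightarrow> 'a) \<Rightarrow> ('a \<Rightarrow> 'a) set \<Rightarrow> 'a \<Rightarrow> 'a"
where
  "anchor A br\<^sub>0 \<alpha> f =
     (let c = (SOME c. c \<in> \<alpha>)
      in \<Oplus>\<^bsub>A\<^esub> h \<in> {h \<in> carrier A. c h \<noteq> \<zero>\<^bsub>A\<^esub>}. c h \<otimes>\<^bsub>A\<^esub> br\<^sub>0 h f)"


section \<open>Poisson triples\<close>

definition contravariant_derivative ::
  "('r, 'q) ring_scheme \<Rightarrow> ('r, 'a, 'x) module_scheme \<Rightarrow> ('a \<Rightarrow> 'a \<Rightarrow> 'a) \<Rightarrow>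
   ('a, 'm, 'y) module_scheme \<Rightarrow> (('a \<Rightarrow> 'a) set \<Rightarrow> 'm \<Rightarrow> 'm) \<Rightarrow> bool"
where
  "contravariant_derivative R A br\<^sub>0 M \<D> \<longleftrightarrow>
     bilinear_map R (restrict_scalars A (kaehler R A)) (restrict_scalars A M) (restrict_scalars A M) \<D> \<and>
     (\<forall>f\<in>carrier A. \<forall>\<alpha>\<in>carrier (kaehler R A). \<forall>\<eta>\<in>carrier M.
        \<D> (f \<odot>\<^bsub>kaehler R A\<^esub> \<alpha>) \<eta> = f \<odot>\<^bsub>M\<^esub> \<D> \<alpha> \<eta> \<and>
        \<D> \<alpha> (f \<odot>\<^bsub>M\<^esub> \<eta>) = f \<odot>\<^bsub>M\<^esub> \<D> \<alpha> \<eta> \<oplus>\<^bsub>M\<^esub> anchor A br\<^sub>0 \<alpha> f \<odot>\<^bsub>M\<^esub> \<eta>)"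

text \<open>\<open>(br\<^sub>1, \<D>, \<K>)\<close> is the Poisson triple corresponding to the admissible bracket \<open>br\<close>.\<close>

definition corresponding_poisson_triple ::
  "('r, 'q) ring_scheme \<Rightarrow> ('r, 'a, 'x) module_scheme \<Rightarrow> ('a \<Rightarrow> 'a \<Rightarrow> 'a) \<Rightarrow>
   ('a, 'm, 'y) module_scheme \<Rightarrow> ('a \<times> 'm \<Rightarrow> 'a \<times> 'm \<Rightarrow> 'a \<times> 'm) \<Rightarrow>
   ('m \<Rightarrow> 'm \<Rightarrow> 'm) \<Rightarrow> (('a \<Rightarrow> 'a) set \<Rightarrow> 'm \<Rightarrow> 'm) \<Rightarrow> (('a \<Rightarrow> 'a) set \<Rightarrow> ('a \<Rightarrow> 'a) set \<Rightarrow> 'm) \<Rightarrow> bool"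
where
  "corresponding_poisson_triple R A br\<^sub>0 M br br\<^sub>1 \<D> \<K> \<longleftrightarrow>
     lie_bracket A M br\<^sub>1 \<and>
     contravariant_derivative R A br\<^sub>0 M \<D> \<and>
     bilinear_map A (kaehler R A) (kaehler R A) M \<K> \<and>
     (\<forall>\<alpha>\<in>carrier (kaehler R A). \<forall>\<beta>\<in>carrier (kaehler R A). \<K> \<alpha> \<beta> = \<ominus>\<^bsub>M\<^esub> \<K> \<beta> \<alpha>) \<and>
     (\<forall>f\<in>carrier A. \<forall>g\<in>carrier A. \<forall>\<eta>\<in>carrier M. \<forall>\<xi>\<in>carrier M.
        br (f, \<eta>) (g, \<xi>) =
          (br\<^sub>0 f g,
           \<D> (kaehler_d R A f) \<xi> \<ominus>\<^bsub>M\<^esub> \<D> (kaehler_d R A g) \<eta> \<oplus>\<^bsub>M\<^esub> br\<^sub>1 \<eta> \<xi>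
             \<oplus>\<^bsub>M\<^esub> \<K> (kaehler_d R A f) (kaehler_d R A g)))"


section \<open>Poisson modules\<close>

definition poisson_module ::
  "('r, 'q) ring_scheme \<Rightarrow> ('r, 'a, 'x) module_scheme \<Rightarrow> ('a \<Rightarrow> 'a \<Rightarrow> 'a) \<Rightarrow>
   ('a, 'm, 'y) module_scheme \<Rightarrow> ('a \<Rightarrow> 'm \<Rightarrow> 'm) \<Rightarrow> bool"
where
  "poisson_module R A br\<^sub>0 M lam \<longleftrightarrow>
     module A M \<and>
     bilinear_map R A (restrict_scalars A M) (restrict_scalars A M) lam \<and>
     (\<forall>f\<in>carrier A. \<forall>g\<in>carrier A. \<forall>\<eta>\<in>carrier M.
        lam f (g \<odot>\<^bsub>M\<^esub> \<eta>) = g \<odot>\<^bsub>M\<^esub> lam f \<eta> \<oplus>\<^bsub>M\<^esub> br\<^sub>0 f g \<odot>\<^bsub>M\<^esub> \<eta> \<and>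
        lam (f \<otimes>\<^bsub>A\<^esub> g) \<eta> = f \<odot>\<^bsub>M\<^esub> lam g \<eta> \<oplus>\<^bsub>M\<^esub> g \<odot>\<^bsub>M\<^esub> lam f \<eta> \<and>
        lam (br\<^sub>0 f g) \<eta> = lam f (lam g \<eta>) \<ominus>\<^bsub>M\<^esub> lam g (lam f \<eta>))"

definition poisson_module_bracket ::
  "('a \<Rightarrow> 'a \<Rightarrow> 'a) \<Rightarrow> ('a, 'm, 'y) module_scheme \<Rightarrow> ('a \<Rightarrow> 'm \<Rightarrow> 'm) \<Rightarrow>
   'a \<times> 'm \<Rightarrow> 'a \<times> 'm \<Rightarrow> 'a \<times> 'm"
where
  "poisson_module_bracket br\<^sub>0 M lam = (\<lambda>(f, \<eta>) (g, \<xi>). (br\<^sub>0 f g, lam f \<xi> \<ominus>\<^bsub>M\<^esub> lam g \<eta>))"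

definition gauge :: "('a, 'm, 'y) module_scheme \<Rightarrow> ('a \<Rightarrow> 'm) \<Rightarrow> 'a \<times> 'm \<Rightarrow> 'a \<times> 'm"
where
  "gauge M \<phi> = (\<lambda>(f, \<eta>). (f, \<phi> f \<oplus>\<^bsub>M\<^esub> \<eta>))"


section \<open>The complex of multiderivations\<close>

text \<open>A \<open>k\<close>-cochain is a function on the lists of length \<open>k\<close> over \<open>A\<close>, extended by
  \<open>undefined\<close> elsewhere so that equality of cochains is equality of functions.\<close>

definition tuples :: "('r, 'a, 'x) module_scheme \<Rightarrow> nat \<Rightarrow> 'a list set"
where
  "tuples A k = {fs. length fs = k \<and> set fs \<subseteq> carrier A}"

definition multiderivations ::
  "('r, 'q) ring_scheme \<Rightarrow> ('r, 'a, 'x) module_scheme \<Rightarrow> ('a, 'm, 'y) module_scheme \<Rightarrow> nat \<Rightarrow>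
   ('a list \<Rightarrow> 'm) set"
where
  "multiderivations R A M k =
     {Q \<in> tuples A k \<rightarrow>\<^sub>E carrier M.
        (\<forall>fs\<in>tuples A k. \<forall>i<k. (\<lambda>f\<in>carrier A. Q (fs[i := f])) \<in> Der R A M) \<and>
        (\<forall>fs\<in>tuples A k. \<forall>i<k. \<forall>j<k. i \<noteq> j \<longrightarrow>
           Q (fs[i := fs ! j, j := fs ! i]) = \<ominus>\<^bsub>M\<^esub> Q fs)}"

definition cochain_group ::
  "('r, 'q) ring_scheme \<Rightarrow> ('r, 'a, 'x) module_scheme \<Rightarrow> ('a, 'm, 'y) module_scheme \<Rightarrow> nat \<Rightarrow>
   ('a list \<Rightarrow> 'm) monoid"
where
  "cochain_group R A M k =
     \<lparr>carrier = multiderivations R A M k,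
      mult = (\<lambda>Q S. \<lambda>fs\<in>tuples A k. Q fs \<oplus>\<^bsub>M\<^esub> S fs),
      one = (\<lambda>fs\<in>tuples A k. \<zero>\<^bsub>M\<^esub>)\<rparr>"

text \<open>\<open>omit I\<close> deletes the entries whose (0-based) positions lie in \<open>I\<close>.\<close>

definition omit :: "nat set \<Rightarrow> 'a list \<Rightarrow> 'a list"
where
  "omit I fs = nths fs (- I)"

definition d_contra ::
  "('r, 'q) ring_scheme \<Rightarrow> ('r, 'a, 'x) module_scheme \<Rightarrow> ('a \<Rightarrow> 'a \<Rightarrow> 'a) \<Rightarrow>
   ('a, 'm, 'y) module_scheme \<Rightarrow> (('a \<Rightarrow> 'a) set \<Rightarrow> 'm \<Rightarrow> 'm) \<Rightarrow> nat \<Rightarrow>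
   ('a list \<Rightarrow> 'm) \<Rightarrow> 'a list \<Rightarrow> 'm"
where
  "d_contra R A br\<^sub>0 M \<D> k Q =
     (\<lambda>fs\<in>tuples A (Suc k).
        (\<Oplus>\<^bsub>M\<^esub> i \<in> {..k}. [((- 1 :: int) ^ i)] \<cdot>\<^bsub>M\<^esub> (\<D> (kaehler_d R A (fs ! i)) (Q (omit {i} fs)))) \<oplus>\<^bsub>M\<^esub>
        (\<Oplus>\<^bsub>M\<^esub> j \<in> {..k}. \<Oplus>\<^bsub>M\<^esub> i \<in> {..<j}.
           [((- 1 :: int) ^ (i + j))] \<cdot>\<^bsub>M\<^esub> (Q (br\<^sub>0 (fs ! i) (fs ! j) # omit {i, j} fs))))"

definition cocycles ::
  "('r, 'q) ring_scheme \<Rightarrow> ('r, 'a, 'x) module_scheme \<Rightarrow> ('a \<Rightarrow> 'a \<Rightarrow> 'a) \<Rightarrow>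
   ('a, 'm, 'y) module_scheme \<Rightarrow> (('a \<Rightarrow> 'a) set \<Rightarrow> 'm \<Rightarrow> 'm) \<Rightarrow> nat \<Rightarrow> ('a list \<Rightarrow> 'm) set"
where
  "cocycles R A br\<^sub>0 M \<D> k =
     {Q \<in> multiderivations R A M k.
        d_contra R A br\<^sub>0 M \<D> k Q = \<one>\<^bsub>cochain_group R A M (Suc k)\<^esub>}"

fun coboundaries ::
  "('r, 'q) ring_scheme \<Rightarrow> ('r, 'a, 'x) module_scheme \<Rightarrow> ('a \<Rightarrow> 'a \<Rightarrow> 'a) \<Rightarrow>
   ('a, 'm, 'y) module_scheme \<Rightarrow> (('a \<Rightarrow> 'a) set \<Rightarrow> 'm \<Rightarrow> 'm) \<Rightarrow> nat \<Rightarrow> ('a list \<Rightarrow> 'm) set"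
where
  "coboundaries R A br\<^sub>0 M \<D> 0 = {\<one>\<^bsub>cochain_group R A M 0\<^esub>}"
| "coboundaries R A br\<^sub>0 M \<D> (Suc k) = d_contra R A br\<^sub>0 M \<D> k ` multiderivations R A M k"

definition cohomology ::
  "('r, 'q) ring_scheme \<Rightarrow> ('r, 'a, 'x) module_scheme \<Rightarrow> ('a \<Rightarrow> 'a \<Rightarrow> 'a) \<Rightarrow>
   ('a, 'm, 'y) module_scheme \<Rightarrow> (('a \<Rightarrow> 'a) set \<Rightarrow> 'm \<Rightarrow> 'm) \<Rightarrow> nat \<Rightarrow>
   ('a list \<Rightarrow> 'm) set monoid"
where
  "cohomology R A br\<^sub>0 M \<D> k =
     (cochain_group R A M k)\<lparr>carrier := cocycles R A br\<^sub>0 M \<D> k\<rparr> Mod coboundaries R A br\<^sub>0 M \<D> k"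

definition cohomology_class ::
  "('r, 'q) ring_scheme \<Rightarrow> ('r, 'a, 'x) module_scheme \<Rightarrow> ('a \<Rightarrow> 'a \<Rightarrow> 'a) \<Rightarrow>
   ('a, 'm, 'y) module_scheme \<Rightarrow> (('a \<Rightarrow> 'a) set \<Rightarrow> 'm \<Rightarrow> 'm) \<Rightarrow> nat \<Rightarrow>
   ('a list \<Rightarrow> 'm) \<Rightarrow> ('a list \<Rightarrow> 'm) set"
where
  "cohomology_class R A br\<^sub>0 M \<D> k Q =
     coboundaries R A br\<^sub>0 M \<D> k
       #>\<^bsub>(cochain_group R A M k)\<lparr>carrier := cocycles R A br\<^sub>0 M \<D> k\<rparr>\<^esub> Q"

definition Delta ::
  "('r, 'q) ring_scheme \<Rightarrow> ('r, 'a, 'x) module_scheme \<Rightarrow>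
   (('a \<Rightarrow> 'a) set \<Rightarrow> ('a \<Rightarrow> 'a) set \<Rightarrow> 'm) \<Rightarrow> 'a list \<Rightarrow> 'm"
where
  "Delta R A \<K> = (\<lambda>fs\<in>tuples A 2. \<K> (kaehler_d R A (fs ! 0)) (kaehler_d R A (fs ! 1)))"

end

theory Submission
  imports Defs
begin

text \<open>Evaluating the bracket on \<open>f \<oplus> 0\<close> and \<open>0 \<oplus> \<eta>\<close> shows that \<open>\<lambda>(f, \<eta>) = \<D>\<^bsub>df\<^esub> \<eta>\<close> is a Poisson
  module structure: its Leibniz rules are those of the bracket, and its flatness is the Jacobi
  identity, because \<open>[ , ]\<^sub>1 = 0\<close>. A gauge transformation respecting the brackets fixes \<open>P\<^sub>1\<close>, so
  this is the only possible target structure. Compatibility on pairs \<open>f \<oplus> 0\<close>, \<open>g \<oplus> 0\<close> then reads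
  \<open>\<K>(df, dg) = \<D>\<^bsub>df\<^esub> (\<phi>\<^sub>1\<^sub>0 g) - \<D>\<^bsub>dg\<^esub> (\<phi>\<^sub>1\<^sub>0 f) - \<phi>\<^sub>1\<^sub>0 {f, g}\<close>, i.e. \<open>\<Delta>\<K> = d\<^sub>\<D> \<phi>\<^sub>1\<^sub>0\<close>.\<close>

section \<open>Signs and additive maps in abelian groups\<close>

lemma (in abelian_group) add_pow_int_1 [simp]: "x \<in> carrier G \<Longrightarrow> [(1::int)] \<cdot> x = x"
  using add.int_pow_1[of x] by (simp add: add_pow_def)

text \<open>The signs in \<open>d_contra\<close> are integer multiples by powers of -1; in degree
  one only the multiples 1 and -1 occur.\<close>

lemma (in abelian_group) add_pow_int_minus_1 [simp]: "x \<in> carrier G \<Longrightarrow> [(-1::int)] \<cdot> x = \<ominus> x"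
  using add.int_pow_neg[of x 1] add.int_pow_1[of x] by (simp add: add_pow_def a_inv_def)

lemma (in abelian_group) a_inv_zero [simp]: "\<ominus> \<zero> = \<zero>"
  by (rule minus_equality) simp_all

lemma (in abelian_group) eq_if_minus_zero:
  assumes "x \<ominus> y = \<zero>" "x \<in> carrier G" "y \<in> carrier G"
  shows "x = y"
  using assms minus_equality[of x "\<ominus> y"] by (simp add: minus_eq)

lemma linear_map_closed:
  "\<lbrakk>linear_map S M N h; x \<in> carrier M\<rbrakk> \<Longrightarrow> h x \<in> carrier N"
  by (auto simp: linear_map_def)

lemma linear_map_add:
  "\<lbrakk>linear_map S M N h; x \<in> carrier M; y \<in> carrier M\<rbrakk> \<Longrightarrow> h (x \<oplus>\<^bsub>M\<^esub> y) = h x \<oplus>\<^bsub>N\<^esub> h y"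
  by (simp add: linear_map_def)

lemma linear_map_smult:
  "\<lbrakk>linear_map S M N h; s \<in> carrier S; x \<in> carrier M\<rbrakk> \<Longrightarrow> h (s \<odot>\<^bsub>M\<^esub> x) = s \<odot>\<^bsub>N\<^esub> h x"
  by (simp add: linear_map_def)

text \<open>Asks for additivity alone, so that maps into or out of
  \<open>restrict_scalars A M\<close> can be treated through the additive group of \<open>M\<close>
  itself.\<close>

lemma additive_zero:
  assumes "abelian_group M" "abelian_group N" "h \<in> carrier M \<rightarrow> carrier N"
    and "\<And>x y. \<lbrakk>x \<in> carrier M; y \<in> carrier M\<rbrakk> \<Longrightarrow> h (x \<oplus>\<^bsub>M\<^esub> y) = h x \<oplus>\<^bsub>N\<^esub> h y"
  shows "h \<zero>\<^bsub>M\<^esub> = \<zero>\<^bsub>N\<^esub>"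
proof -
  interpret M: abelian_group M by fact
  interpret N: abelian_group N by fact
  have c: "h \<zero>\<^bsub>M\<^esub> \<in> carrier N" using assms(3) by auto
  have "h \<zero>\<^bsub>M\<^esub> \<oplus>\<^bsub>N\<^esub> h \<zero>\<^bsub>M\<^esub> = h \<zero>\<^bsub>M\<^esub>"
    using assms(4)[of "\<zero>\<^bsub>M\<^esub>" "\<zero>\<^bsub>M\<^esub>"] by simp
  then show ?thesis using c by (metis N.add.l_cancel_one')
qed

lemma linear_map_zero:
  "\<lbrakk>abelian_group M; abelian_group N; linear_map S M N h\<rbrakk> \<Longrightarrow> h \<zero>\<^bsub>M\<^esub> = \<zero>\<^bsub>N\<^esub>"
  by (rule additive_zero) (auto simp: linear_map_def)

lemma additive_minus:
  assumes "abelian_group M" "abelian_group N" "h \<in> carrier M \<rightarrow> carrier N"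
    and add: "\<And>x y. \<lbrakk>x \<in> carrier M; y \<in> carrier M\<rbrakk> \<Longrightarrow> h (x \<oplus>\<^bsub>M\<^esub> y) = h x \<oplus>\<^bsub>N\<^esub> h y"
    and x: "x \<in> carrier M"
  shows "h (\<ominus>\<^bsub>M\<^esub> x) = \<ominus>\<^bsub>N\<^esub> h x"
proof -
  interpret M: abelian_group M by fact
  interpret N: abelian_group N by fact
  have c: "h x \<in> carrier N" "h (\<ominus>\<^bsub>M\<^esub> x) \<in> carrier N" using assms(3) x by auto
  have "h (\<ominus>\<^bsub>M\<^esub> x) \<oplus>\<^bsub>N\<^esub> h x = \<zero>\<^bsub>N\<^esub>"
    using add[of "\<ominus>\<^bsub>M\<^esub> x" x] x additive_zero[OF assms(1-4)] by (simp add: M.l_neg)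
  then show ?thesis using c by (metis N.minus_equality)
qed

section \<open>Restricted scalars, semidirect product and bracket laws\<close>

lemma restrict_scalars_simps [simp]:
  "carrier (restrict_scalars A M) = carrier M"
  "\<zero>\<^bsub>restrict_scalars A M\<^esub> = \<zero>\<^bsub>M\<^esub>"
  "x \<oplus>\<^bsub>restrict_scalars A M\<^esub> y = x \<oplus>\<^bsub>M\<^esub> y"
  "r \<odot>\<^bsub>restrict_scalars A M\<^esub> x = (r \<odot>\<^bsub>A\<^esub> \<one>\<^bsub>A\<^esub>) \<odot>\<^bsub>M\<^esub> x"
  by (simp_all add: restrict_scalars_def)

lemma semidirect_simps [simp]:
  "carrier (semidirect A M) = carrier A \<times> carrier M"
  "\<zero>\<^bsub>semidirect A M\<^esub> = (\<zero>\<^bsub>A\<^esub>, \<zero>\<^bsub>M\<^esub>)"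
  "\<one>\<^bsub>semidirect A M\<^esub> = (\<one>\<^bsub>A\<^esub>, \<zero>\<^bsub>M\<^esub>)"
  "(f, \<eta>) \<oplus>\<^bsub>semidirect A M\<^esub> (g, \<xi>) = (f \<oplus>\<^bsub>A\<^esub> g, \<eta> \<oplus>\<^bsub>M\<^esub> \<xi>)"
  "(f, \<eta>) \<otimes>\<^bsub>semidirect A M\<^esub> (g, \<xi>) = (f \<otimes>\<^bsub>A\<^esub> g, f \<odot>\<^bsub>M\<^esub> \<xi> \<oplus>\<^bsub>M\<^esub> g \<odot>\<^bsub>M\<^esub> \<eta>)"
  "r \<odot>\<^bsub>semidirect A M\<^esub> (f, \<eta>) = (r \<odot>\<^bsub>A\<^esub> f, (r \<odot>\<^bsub>A\<^esub> \<one>\<^bsub>A\<^esub>) \<odot>\<^bsub>M\<^esub> \<eta>)"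
  by (simp_all add: semidirect_def)

lemma poisson_algebraD:
  assumes "poisson_algebra R A br"
  shows "algebra R A" "lie_bracket R A br"
    and "\<And>x y z. \<lbrakk>x \<in> carrier A; y \<in> carrier A; z \<in> carrier A\<rbrakk> \<Longrightarrow>
      br x (y \<otimes>\<^bsub>A\<^esub> z) = br x y \<otimes>\<^bsub>A\<^esub> z \<oplus>\<^bsub>A\<^esub> y \<otimes>\<^bsub>A\<^esub> br x z"
    and "\<And>x y z. \<lbrakk>x \<in> carrier A; y \<in> carrier A; z \<in> carrier A\<rbrakk> \<Longrightarrow>
      br (x \<otimes>\<^bsub>A\<^esub> y) z = x \<otimes>\<^bsub>A\<^esub> br y z \<oplus>\<^bsub>A\<^esub> y \<otimes>\<^bsub>A\<^esub> br x z"
  using assms by (auto simp: poisson_algebra_def)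

lemma lie_bracketD:
  assumes "lie_bracket R A br"
  shows "\<And>x. x \<in> carrier A \<Longrightarrow> linear_map R A A (br x)"
    and "\<And>y. y \<in> carrier A \<Longrightarrow> linear_map R A A (\<lambda>x. br x y)"
    and "\<And>x y z. \<lbrakk>x \<in> carrier A; y \<in> carrier A; z \<in> carrier A\<rbrakk> \<Longrightarrow>
      br x (br y z) \<oplus>\<^bsub>A\<^esub> br y (br z x) \<oplus>\<^bsub>A\<^esub> br z (br x y) = \<zero>\<^bsub>A\<^esub>"
  using assms by (auto simp: lie_bracket_def bilinear_map_def)

section \<open>Exact differentials and tuples of length one and two\<close>

lemma kaehler_d_closed:
  assumes "cring A" "f \<in> carrier A"
  shows "kaehler_d R A f \<in> carrier (kaehler R A)"
proof -
  interpret A: cring A by fact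
  \<comment> \<open>The generator is supported at \<open>f\<close> at most, so it lies in the free
    module and its coset is an element of the quotient.\<close>
  have "finite {h \<in> carrier A. free_gen A f h \<noteq> \<zero>\<^bsub>A\<^esub>}"
    by (rule finite_subset[of _ "{f}"]) (auto simp: free_gen_def split: if_splits)
  then have "free_gen A f \<in> carrier (free_module A)"
    by (auto simp: free_module_def free_gen_def)
  then show ?thesis
    by (auto simp: kaehler_def kaehler_d_def A_RCOSETS_def' a_r_coset_def')
qed

lemma tuples_1: "tuples A (Suc 0) = {[f] | f. f \<in> carrier A}"
  by (auto simp: tuples_def length_Suc_conv)

lemma tuples_2: "tuples A (Suc (Suc 0)) = {[f, g] | f g. f \<in> carrier A \<and> g \<in> carrier A}"
  by (auto simp: tuples_def length_Suc_conv)

lemma omit_pair [simp]: "omit {0} [f, g] = [g]" "omit {Suc 0} [f, g] = [f]"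
    "omit {0, Suc 0} [f, g] = []"
  by (simp_all add: omit_def nths_Cons)

section \<open>Derivations and 1-cochains\<close>

lemma DerD:
  assumes "\<phi> \<in> Der R A M"
  shows "linear_map R A (restrict_scalars A M) \<phi>"
    and "\<phi> \<in> carrier A \<rightarrow> carrier M"
    and "\<And>f g. \<lbrakk>f \<in> carrier A; g \<in> carrier A\<rbrakk> \<Longrightarrow> \<phi> (f \<oplus>\<^bsub>A\<^esub> g) = \<phi> f \<oplus>\<^bsub>M\<^esub> \<phi> g"
    and "\<And>f. f \<in> carrier A \<Longrightarrow> \<phi> f \<in> carrier M"
    and "\<And>f g. \<lbrakk>f \<in> carrier A; g \<in> carrier A\<rbrakk> \<Longrightarrow>
      \<phi> (f \<otimes>\<^bsub>A\<^esub> g) = f \<odot>\<^bsub>M\<^esub> \<phi> g \<oplus>\<^bsub>M\<^esub> g \<odot>\<^bsub>M\<^esub> \<phi> f"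
  using assms by (auto simp: Der_def linear_map_def)

locale algebra_module = A: algebra R A + M: module A M
  for R :: "('r, 'q) ring_scheme" and A :: "('r, 'a, 'x) module_scheme"
    and M :: "('a, 'm, 'y) module_scheme"
begin

lemma Der_zero: "(\<lambda>f\<in>carrier A. \<zero>\<^bsub>M\<^esub>) \<in> Der R A M"
  by (auto simp: Der_def linear_map_def M.smult_r_null)

lemma Der_add:
  assumes "\<phi> \<in> Der R A M" "\<psi> \<in> Der R A M"
  shows "(\<lambda>f\<in>carrier A. \<phi> f \<oplus>\<^bsub>M\<^esub> \<psi> f) \<in> Der R A M"
  using assms
  by (auto simp: Der_def linear_map_def M.smult_r_distr M.a_ac Pi_iff PiE_iff)

lemma Der_minus:
  assumes "\<phi> \<in> Der R A M"
  shows "(\<lambda>f\<in>carrier A. \<ominus>\<^bsub>M\<^esub> \<phi> f) \<in> Der R A M"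
  using assms
  by (auto simp: Der_def linear_map_def M.smult_r_minus M.minus_add M.a_ac Pi_iff PiE_iff)

text \<open>The product rule for 1 * 1 = 1 makes the value equal to its own double. This is what
  lets a gauge transformation fix the unit.\<close>

lemma Der_one:
  assumes "\<phi> \<in> Der R A M"
  shows "\<phi> \<one>\<^bsub>A\<^esub> = \<zero>\<^bsub>M\<^esub>"
proof -
  have c: "\<phi> \<one>\<^bsub>A\<^esub> \<in> carrier M" using DerD(4)[OF assms] by simp
  then have "\<phi> \<one>\<^bsub>A\<^esub> = \<phi> \<one>\<^bsub>A\<^esub> \<oplus>\<^bsub>M\<^esub> \<phi> \<one>\<^bsub>A\<^esub>"
    using DerD(5)[OF assms, of "\<one>\<^bsub>A\<^esub>" "\<one>\<^bsub>A\<^esub>"] by simp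
  then show ?thesis using c by (metis M.add.l_cancel_one')
qed

text \<open>A list of length one has no two distinct positions, so skew-symmetry is vacuous and only
  the derivation condition in the single slot remains.\<close>

lemma multiderivations_1:
  "multiderivations R A M (Suc 0) = (\<lambda>\<phi>. \<lambda>fs\<in>tuples A (Suc 0). \<phi> (fs ! 0)) ` Der R A M"
    (is "?L = ?h ` _")
proof (intro equalityI subsetI)
  fix Q assume Q: "Q \<in> ?L"
  let ?\<phi> = "\<lambda>f\<in>carrier A. Q [f]"
  have ext: "Q \<in> tuples A (Suc 0) \<rightarrow>\<^sub>E carrier M"
    and der: "\<forall>fs\<in>tuples A (Suc 0). \<forall>i<Suc 0. (\<lambda>f\<in>carrier A. Q (fs[i := f])) \<in> Der R A M"
    using Q by (simp_all add: multiderivations_def)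
  \<comment> \<open>Any singleton would do: its only entry is overwritten by \<open>f\<close> in the
    derivation condition.\<close>
  have "[\<zero>\<^bsub>A\<^esub>] \<in> tuples A (Suc 0)" by (simp add: tuples_1)
  from bspec[OF der this] have "?\<phi> \<in> Der R A M" by simp
  moreover have "Q = ?h ?\<phi>"
  proof (rule extensionalityI[of _ "tuples A (Suc 0)"])
    show "Q \<in> extensional (tuples A (Suc 0))" using ext by (simp add: PiE_iff)
  qed (auto simp: tuples_1)
  ultimately show "Q \<in> ?h ` Der R A M" by (intro image_eqI)
next
  fix Q assume "Q \<in> ?h ` Der R A M"
  then obtain \<phi> where \<phi>: "\<phi> \<in> Der R A M" and Q: "Q = ?h \<phi>" by auto
  have ext: "\<phi> \<in> carrier A \<rightarrow>\<^sub>E carrier M" using \<phi> by (simp add: Der_def)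
  have "(\<lambda>f\<in>carrier A. Q [f]) = \<phi>"
  proof (rule extensionalityI[of _ "carrier A"])
    show "\<phi> \<in> extensional (carrier A)" using ext by (simp add: PiE_iff)
  qed (auto simp: Q tuples_1)
  moreover have "Q \<in> tuples A (Suc 0) \<rightarrow>\<^sub>E carrier M"
    unfolding Q by (rule restrict_PiE_iff[THEN iffD2]) (use ext in \<open>auto simp: tuples_1\<close>)
  ultimately show "Q \<in> ?L"
    unfolding multiderivations_def mem_Collect_eq using \<phi> by (intro conjI ballI allI impI) (auto simp: tuples_1)
qed

section \<open>Gauge transformations of the semidirect product\<close>

lemma gauge_ring_iso:
  assumes \<phi>: "\<phi> \<in> Der R A M"
  shows "gauge M \<phi> \<in> ring_iso (semidirect A M) (semidirect A M)"
proof -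
  note D = DerD[OF \<phi>]
  \<comment> \<open>The inverse is the gauge transformation of the negated derivation.\<close>
  have "bij_betw (gauge M \<phi>) (carrier A \<times> carrier M) (carrier A \<times> carrier M)"
  proof (rule bij_betw_byWitness[where f' = "\<lambda>(f, \<eta>). (f, \<ominus>\<^bsub>M\<^esub> \<phi> f \<oplus>\<^bsub>M\<^esub> \<eta>)"])
  qed (auto simp: gauge_def D(4) M.r_neg1 M.r_neg2)
  \<comment> \<open>Multiplicativity is exactly the product rule of \<open>\<phi>\<close>.\<close>
  moreover have "gauge M \<phi> \<in> ring_hom (semidirect A M) (semidirect A M)"
    by (rule ring_hom_memI)
      (auto simp: gauge_def D(3-5) Der_one[OF \<phi>] M.smult_r_distr M.a_ac)
  ultimately show ?thesis by (simp add: ring_iso_def)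
qed

lemma gauge_linear:
  assumes \<phi>: "\<phi> \<in> Der R A M"
  shows "linear_map R (semidirect A M) (semidirect A M) (gauge M \<phi>)"
proof -
  note D = DerD[OF \<phi>]
  show ?thesis
    using linear_map_smult[OF D(1)]
    by (auto simp: linear_map_def gauge_def D(3-4) M.smult_r_distr M.a_ac)
qed

end

text \<open>The bracket on \<open>P\<^sub>0 \<ltimes> P\<^sub>1\<close> already encodes everything that is needed about \<open>\<D>\<close> and \<open>\<K>\<close> on
  exact differentials, so that no relation in \<open>\<Omega>\<^sup>1\<close> has to be used.\<close>

locale abelian_poisson_triple =
  fixes R :: "('r, 'q) ring_scheme"
    and A :: "('r, 'a, 'x) module_scheme"
    and M :: "('a, 'm, 'y) module_scheme"
    and br\<^sub>0 :: "'a \<Rightarrow> 'a \<Rightarrow> 'a"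
    and br :: "'a \<times> 'm \<Rightarrow> 'a \<times> 'm \<Rightarrow> 'a \<times> 'm"
    and \<D> :: "('a \<Rightarrow> 'a) set \<Rightarrow> 'm \<Rightarrow> 'm"
    and \<K> :: "('a \<Rightarrow> 'a) set \<Rightarrow> ('a \<Rightarrow> 'a) set \<Rightarrow> 'm"
  assumes poisson: "poisson_algebra R A br\<^sub>0"
    and is_module: "module A M"
    and admissible: "admissible_poisson R A br\<^sub>0 M br"
    and triple: "corresponding_poisson_triple R A br\<^sub>0 M br (\<lambda>\<eta> \<xi>. \<zero>\<^bsub>M\<^esub>) \<D> \<K>"
begin

sublocale algebra_module R A M
  using poisson is_module by (simp add: algebra_module_def poisson_algebra_def)

abbreviation D :: "'a \<Rightarrow> 'm \<Rightarrow> 'm" where "D f \<equiv> \<D> (kaehler_d R A f)"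
abbreviation K :: "'a \<Rightarrow> 'a \<Rightarrow> 'm" where "K f g \<equiv> \<K> (kaehler_d R A f) (kaehler_d R A g)"

section \<open>The admissible bracket in components\<close>

lemmas d_closed = kaehler_d_closed[OF A.is_cring]

lemma ext_poisson: "poisson_algebra R (semidirect A M) br"
  using admissible by (simp add: admissible_poisson_def)

lemmas br\<^sub>0_lie = lie_bracketD[OF poisson_algebraD(2)[OF poisson]]
lemmas br_lie = lie_bracketD[OF poisson_algebraD(2)[OF ext_poisson]]

text \<open>Admissibility includes that the semidirect product is an algebra, which supplies its
  group laws.\<close>

lemma semidirect_group: "abelian_group (semidirect A M)"
  using poisson_algebraD(1)[OF ext_poisson] by (simp add: algebra_def module_def)

lemma br\<^sub>0_closed [simp]: "\<lbrakk>f \<in> carrier A; g \<in> carrier A\<rbrakk> \<Longrightarrow> br\<^sub>0 f g \<in> carrier A"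
  using br\<^sub>0_lie(1) linear_map_closed by metis

lemma br\<^sub>0_zero [simp]:
  "f \<in> carrier A \<Longrightarrow> br\<^sub>0 f \<zero>\<^bsub>A\<^esub> = \<zero>\<^bsub>A\<^esub>"
  "f \<in> carrier A \<Longrightarrow> br\<^sub>0 \<zero>\<^bsub>A\<^esub> f = \<zero>\<^bsub>A\<^esub>"
  using linear_map_zero[OF A.abelian_group_axioms A.abelian_group_axioms] br\<^sub>0_lie(1,2) by blast+

lemma triple_facts:
  "contravariant_derivative R A br\<^sub>0 M \<D>"
  "bilinear_map A (kaehler R A) (kaehler R A) M \<K>"
  "\<forall>f\<in>carrier A. \<forall>g\<in>carrier A. \<forall>\<eta>\<in>carrier M. \<forall>\<xi>\<in>carrier M.
    br (f, \<eta>) (g, \<xi>) = (br\<^sub>0 f g, D f \<xi> \<ominus>\<^bsub>M\<^esub> D g \<eta> \<oplus>\<^bsub>M\<^esub> \<zero>\<^bsub>M\<^esub> \<oplus>\<^bsub>M\<^esub> K f g)"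
  using triple unfolding corresponding_poisson_triple_def by blast+

lemma D_linear: "f \<in> carrier A \<Longrightarrow> linear_map R (restrict_scalars A M) (restrict_scalars A M) (D f)"
  using triple_facts(1) d_closed by (auto simp: contravariant_derivative_def bilinear_map_def)

lemma D_closed [simp]: "\<lbrakk>f \<in> carrier A; \<eta> \<in> carrier M\<rbrakk> \<Longrightarrow> D f \<eta> \<in> carrier M"
  using linear_map_closed[OF D_linear] by simp

lemma D_add:
  "\<lbrakk>f \<in> carrier A; \<eta> \<in> carrier M; \<xi> \<in> carrier M\<rbrakk> \<Longrightarrow> D f (\<eta> \<oplus>\<^bsub>M\<^esub> \<xi>) = D f \<eta> \<oplus>\<^bsub>M\<^esub> D f \<xi>"
  using linear_map_add[OF D_linear] by simp

lemma D_zero [simp]: "f \<in> carrier A \<Longrightarrow> D f \<zero>\<^bsub>M\<^esub> = \<zero>\<^bsub>M\<^esub>"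
  by (rule additive_zero[OF M.abelian_group_axioms M.abelian_group_axioms, of "D f"])
    (auto simp: D_add)

lemma D_minus: "\<lbrakk>f \<in> carrier A; \<eta> \<in> carrier M\<rbrakk> \<Longrightarrow> D f (\<ominus>\<^bsub>M\<^esub> \<eta>) = \<ominus>\<^bsub>M\<^esub> D f \<eta>"
  by (rule additive_minus[OF M.abelian_group_axioms M.abelian_group_axioms, of "D f"])
    (auto simp: D_add)

lemma K_closed [simp]: "\<lbrakk>f \<in> carrier A; g \<in> carrier A\<rbrakk> \<Longrightarrow> K f g \<in> carrier M"
  using triple_facts(2) linear_map_closed d_closed unfolding bilinear_map_def by metis

lemma br_pair:
  "\<lbrakk>f \<in> carrier A; g \<in> carrier A; \<eta> \<in> carrier M; \<xi> \<in> carrier M\<rbrakk> \<Longrightarrow>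
    br (f, \<eta>) (g, \<xi>) = (br\<^sub>0 f g, D f \<xi> \<ominus>\<^bsub>M\<^esub> D g \<eta> \<oplus>\<^bsub>M\<^esub> K f g)"
  using triple_facts(3) d_closed by (simp add: M.minus_eq)

lemma br_zero:
  "x \<in> carrier A \<times> carrier M \<Longrightarrow> br x (\<zero>\<^bsub>A\<^esub>, \<zero>\<^bsub>M\<^esub>) = (\<zero>\<^bsub>A\<^esub>, \<zero>\<^bsub>M\<^esub>)"
  "x \<in> carrier A \<times> carrier M \<Longrightarrow> br (\<zero>\<^bsub>A\<^esub>, \<zero>\<^bsub>M\<^esub>) x = (\<zero>\<^bsub>A\<^esub>, \<zero>\<^bsub>M\<^esub>)"
  using linear_map_zero[OF semidirect_group semidirect_group br_lie(1), of x]
    linear_map_zero[OF semidirect_group semidirect_group br_lie(2), of x] by simp_all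

text \<open>Bracketing \<open>(f, 0)\<close> with zero gives zero, and in the second component only
  the \<open>K\<close> term is left. The class of d 0 in the Kaehler module never has to be
  computed.\<close>

lemma K_zero [simp]:
  "f \<in> carrier A \<Longrightarrow> K f \<zero>\<^bsub>A\<^esub> = \<zero>\<^bsub>M\<^esub>"
  "f \<in> carrier A \<Longrightarrow> K \<zero>\<^bsub>A\<^esub> f = \<zero>\<^bsub>M\<^esub>"
  using br_zero[of "(f, \<zero>\<^bsub>M\<^esub>)"] by (simp_all add: br_pair M.minus_eq)

lemma D_zero_left [simp]: "\<eta> \<in> carrier M \<Longrightarrow> D \<zero>\<^bsub>A\<^esub> \<eta> = \<zero>\<^bsub>M\<^esub>"
  using br_zero(2)[of "(\<zero>\<^bsub>A\<^esub>, \<eta>)"] by (simp add: br_pair M.minus_eq)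

text \<open>The terms with \<open>D\<close> or \<open>K\<close> at zero vanish and the bracket on
  \<open>M\<close> is zero, so \<open>\<eta>\<close> does not contribute. Identities of
  \<open>br\<close> with one entry \<open>(0, \<xi>)\<close> thereby become identities of
  \<open>D\<close>.\<close>

lemma br_left [simp]:
  "\<lbrakk>f \<in> carrier A; \<eta> \<in> carrier M; \<xi> \<in> carrier M\<rbrakk> \<Longrightarrow> br (f, \<eta>) (\<zero>\<^bsub>A\<^esub>, \<xi>) = (\<zero>\<^bsub>A\<^esub>, D f \<xi>)"
  by (simp add: br_pair M.minus_eq)

lemma br_right [simp]:
  "\<lbrakk>f \<in> carrier A; \<eta> \<in> carrier M; \<xi> \<in> carrier M\<rbrakk> \<Longrightarrow> br (\<zero>\<^bsub>A\<^esub>, \<xi>) (f, \<eta>) = (\<zero>\<^bsub>A\<^esub>, \<ominus>\<^bsub>M\<^esub> D f \<xi>)"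
  by (simp add: br_pair M.minus_eq)

section \<open>The Poisson module laws for \<open>D\<close>\<close>

lemma D_add_left:
  "\<lbrakk>f \<in> carrier A; g \<in> carrier A; \<eta> \<in> carrier M\<rbrakk> \<Longrightarrow> D (f \<oplus>\<^bsub>A\<^esub> g) \<eta> = D f \<eta> \<oplus>\<^bsub>M\<^esub> D g \<eta>"
  using linear_map_add[OF br_lie(2), of "(\<zero>\<^bsub>A\<^esub>, \<eta>)" "(f, \<zero>\<^bsub>M\<^esub>)" "(g, \<zero>\<^bsub>M\<^esub>)"] by simp

lemma D_smult_left:
  "\<lbrakk>r \<in> carrier R; f \<in> carrier A; \<eta> \<in> carrier M\<rbrakk> \<Longrightarrow> D (r \<odot>\<^bsub>A\<^esub> f) \<eta> = (r \<odot>\<^bsub>A\<^esub> \<one>\<^bsub>A\<^esub>) \<odot>\<^bsub>M\<^esub> D f \<eta>"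
  using linear_map_smult[OF br_lie(2), of "(\<zero>\<^bsub>A\<^esub>, \<eta>)" r "(f, \<zero>\<^bsub>M\<^esub>)"]
  by (simp add: M.smult_r_null)

text \<open>The product of \<open>(g, 0)\<close> and \<open>(0, \<eta>)\<close> is \<open>g\<close>
  acting on \<open>\<eta>\<close>, so this is the Leibniz rule of \<open>br\<close> in its second
  argument. \<open>K f g\<close> disappears because multiplication by \<open>(0, \<eta>)\<close>
  lets zero act on it. The value \<open>br\<^sub>0 f g\<close> comes directly from the first
  component, without evaluating \<open>anchor\<close> on a representative.\<close>

lemma D_module_Leibniz:
  "\<lbrakk>f \<in> carrier A; g \<in> carrier A; \<eta> \<in> carrier M\<rbrakk> \<Longrightarrow>
    D f (g \<odot>\<^bsub>M\<^esub> \<eta>) = g \<odot>\<^bsub>M\<^esub> D f \<eta> \<oplus>\<^bsub>M\<^esub> br\<^sub>0 f g \<odot>\<^bsub>M\<^esub> \<eta>"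
  using poisson_algebraD(3)[OF ext_poisson, of "(f, \<zero>\<^bsub>M\<^esub>)" "(g, \<zero>\<^bsub>M\<^esub>)" "(\<zero>\<^bsub>A\<^esub>, \<eta>)"]
  by (simp add: br_pair M.smult_r_null M.smult_l_null M.minus_eq M.a_comm)

text \<open>The Leibniz rule of \<open>br\<close> in its first argument, for \<open>(f, 0)\<close>
  times \<open>(g, 0)\<close> against \<open>(0, \<eta>)\<close>; it stands in for d(fg) = f dg + g
  df.\<close>

lemma D_mult_left:
  "\<lbrakk>f \<in> carrier A; g \<in> carrier A; \<eta> \<in> carrier M\<rbrakk> \<Longrightarrow>
    D (f \<otimes>\<^bsub>A\<^esub> g) \<eta> = f \<odot>\<^bsub>M\<^esub> D g \<eta> \<oplus>\<^bsub>M\<^esub> g \<odot>\<^bsub>M\<^esub> D f \<eta>"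
  using poisson_algebraD(4)[OF ext_poisson, of "(f, \<zero>\<^bsub>M\<^esub>)" "(g, \<zero>\<^bsub>M\<^esub>)" "(\<zero>\<^bsub>A\<^esub>, \<eta>)"]
  by (simp add: M.smult_r_null M.smult_l_null)

text \<open>The Jacobi identity for \<open>(f, 0)\<close>, \<open>(g, 0)\<close> and
  \<open>(0, \<eta>)\<close>. \<open>K f g\<close> could enter only through its bracket with
  \<open>\<eta>\<close> inside \<open>M\<close>, which is zero.\<close>

lemma D_flat:
  assumes f: "f \<in> carrier A" "g \<in> carrier A" "\<eta> \<in> carrier M"
  shows "D (br\<^sub>0 f g) \<eta> = D f (D g \<eta>) \<ominus>\<^bsub>M\<^esub> D g (D f \<eta>)"
proof -
  have "br (f, \<zero>\<^bsub>M\<^esub>) (g, \<zero>\<^bsub>M\<^esub>) = (br\<^sub>0 f g, K f g)"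
    using f by (simp add: br_pair M.minus_eq)
  then have "D f (D g \<eta>) \<ominus>\<^bsub>M\<^esub> D g (D f \<eta>) \<ominus>\<^bsub>M\<^esub> D (br\<^sub>0 f g) \<eta> = \<zero>\<^bsub>M\<^esub>"
    using br_lie(3)[of "(f, \<zero>\<^bsub>M\<^esub>)" "(g, \<zero>\<^bsub>M\<^esub>)" "(\<zero>\<^bsub>A\<^esub>, \<eta>)"] f
    by (simp add: D_minus M.minus_eq)
  then have "D f (D g \<eta>) \<ominus>\<^bsub>M\<^esub> D g (D f \<eta>) = D (br\<^sub>0 f g) \<eta>"
    by (rule M.eq_if_minus_zero) (use f in simp_all)
  then show ?thesis by simp
qed

lemma poisson_module_D: "poisson_module R A br\<^sub>0 M D"
  unfolding poisson_module_def bilinear_map_def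
  using is_module D_linear D_module_Leibniz D_mult_left D_flat
  by (auto simp: linear_map_def D_add_left D_smult_left)

section \<open>Coboundaries and the trivial class in degree two\<close>

definition cobdry :: "('a \<Rightarrow> 'm) \<Rightarrow> 'a list \<Rightarrow> 'm" where
  "cobdry \<phi> = (\<lambda>fs\<in>tuples A 2. D (fs ! 0) (\<phi> (fs ! 1)) \<ominus>\<^bsub>M\<^esub> D (fs ! 1) (\<phi> (fs ! 0))
      \<ominus>\<^bsub>M\<^esub> \<phi> (br\<^sub>0 (fs ! 0) (fs ! 1)))"

text \<open>Replaces 1-cochains on singleton lists by derivations on \<open>A\<close>, and the
  alternating sums by three explicit terms.\<close>

lemma d_contra_1:
  assumes \<phi>: "\<phi> \<in> Der R A M"
  shows "d_contra R A br\<^sub>0 M \<D> (Suc 0) (\<lambda>fs\<in>tuples A (Suc 0). \<phi> (fs ! 0)) = cobdry \<phi>"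
proof (rule extensionalityI[of _ "tuples A 2"])
  show "d_contra R A br\<^sub>0 M \<D> (Suc 0) (\<lambda>fs\<in>tuples A (Suc 0). \<phi> (fs ! 0)) \<in> extensional (tuples A 2)"
    by (simp add: d_contra_def numeral_2_eq_2)
  show "cobdry \<phi> \<in> extensional (tuples A 2)"
    by (simp add: cobdry_def)
  fix fs assume fs: "fs \<in> tuples A 2"
  then obtain f g where fs_eq: "fs = [f, g]" and fg: "f \<in> carrier A" "g \<in> carrier A"
    by (auto simp: numeral_2_eq_2 tuples_2)
  define Q where "Q = (\<lambda>fs\<in>tuples A (Suc 0). \<phi> (fs ! 0))"
  have \<phi>M: "\<phi> f \<in> carrier M" "\<phi> g \<in> carrier M" "\<phi> (br\<^sub>0 f g) \<in> carrier M"
    using DerD(4)[OF \<phi>] fg by simp_all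
  have Q: "Q [h] = \<phi> h" if "h \<in> carrier A" for h
    using that by (simp add: Q_def tuples_1)
  \<comment> \<open>The inner index set is empty for \<open>j = 0\<close>, so the double sum reduces
    to the pair \<open>i = 0\<close>, \<open>j = 1\<close>, whose sign is -1.\<close>
  have idx: "{..Suc 0} = {0, Suc 0}" "{..<Suc 0} = {0}" "{..<0::nat} = {}" by auto
  have "d_contra R A br\<^sub>0 M \<D> (Suc 0) Q fs =
     D f (\<phi> g) \<oplus>\<^bsub>M\<^esub> \<ominus>\<^bsub>M\<^esub> D g (\<phi> f) \<oplus>\<^bsub>M\<^esub> \<ominus>\<^bsub>M\<^esub> \<phi> (br\<^sub>0 f g)"
    using fs fg \<phi>M unfolding d_contra_def numeral_2_eq_2[symmetric] fs_eq idx
    by (simp add: Q M.finsum_insert idx)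
  then show "d_contra R A br\<^sub>0 M \<D> (Suc 0) (\<lambda>fs\<in>tuples A (Suc 0). \<phi> (fs ! 0)) fs = cobdry \<phi> fs"
    unfolding Q_def using fs by (simp add: cobdry_def fs_eq M.minus_eq)
qed

lemma coboundaries_2: "coboundaries R A br\<^sub>0 M \<D> 2 = cobdry ` Der R A M"
  by (simp add: numeral_2_eq_2 multiderivations_1 image_image d_contra_1)

lemma cobdry_add:
  assumes "\<phi> \<in> Der R A M" "\<psi> \<in> Der R A M"
  shows "(\<lambda>fs\<in>tuples A 2. cobdry \<phi> fs \<oplus>\<^bsub>M\<^esub> cobdry \<psi> fs) =
    cobdry (\<lambda>f\<in>carrier A. \<phi> f \<oplus>\<^bsub>M\<^esub> \<psi> f)"
proof -
  note [simp] = DerD(4)[OF assms(1)] DerD(4)[OF assms(2)]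
  show ?thesis
    by (auto simp: fun_eq_iff cobdry_def numeral_2_eq_2 tuples_2 D_add M.minus_eq M.minus_add M.a_ac)
qed

text \<open>The witness is the difference of \<open>\<psi>\<close> and \<open>\<phi>\<close>:
  coboundaries are closed under subtraction, in the form of solving a translation equation.\<close>

lemma cobdry_cancel:
  assumes \<phi>: "\<phi> \<in> Der R A M" and \<psi>: "\<psi> \<in> Der R A M"
  shows "\<exists>\<chi>\<in>Der R A M. (\<lambda>fs\<in>tuples A 2. cobdry \<chi> fs \<oplus>\<^bsub>M\<^esub> cobdry \<phi> fs) = cobdry \<psi>"
proof (rule bexI)
  define \<chi> where "\<chi> = (\<lambda>f\<in>carrier A. \<psi> f \<oplus>\<^bsub>M\<^esub> (\<lambda>f\<in>carrier A. \<ominus>\<^bsub>M\<^esub> \<phi> f) f)"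
  show \<chi>: "\<chi> \<in> Der R A M"
    unfolding \<chi>_def by (rule Der_add[OF \<psi> Der_minus[OF \<phi>]])
  have "(\<lambda>f\<in>carrier A. \<chi> f \<oplus>\<^bsub>M\<^esub> \<phi> f) = \<psi>"
  proof (rule extensionalityI[of _ "carrier A"])
    show "\<psi> \<in> extensional (carrier A)" using \<psi> by (simp add: Der_def PiE_iff)
  qed (simp_all add: \<chi>_def DerD(4)[OF \<phi>] DerD(4)[OF \<psi>] M.a_assoc M.l_neg)
  then show "(\<lambda>fs\<in>tuples A 2. cobdry \<chi> fs \<oplus>\<^bsub>M\<^esub> cobdry \<phi> fs) = cobdry \<psi>"
    by (simp only: cobdry_add[OF \<chi> \<phi>])
qed

text \<open>The unit of the quotient is the set of coboundaries itself, and the class is its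
  translate by \<open>Delta R A \<K>\<close>. A translate of a set containing zero and closed under
  sums and differences equals that set exactly when the translating element belongs to it.\<close>

lemma class_trivial_iff:
  "cohomology_class R A br\<^sub>0 M \<D> 2 (Delta R A \<K>) = \<one>\<^bsub>cohomology R A br\<^sub>0 M \<D> 2\<^esub>
    \<longleftrightarrow> (\<exists>\<phi>\<in>Der R A M. Delta R A \<K> = cobdry \<phi>)" (is "?L \<longleftrightarrow> ?R")
proof -
  let ?B = "cobdry ` Der R A M"
  define s where "s = (\<lambda>b. \<lambda>fs\<in>tuples A 2. b fs \<oplus>\<^bsub>M\<^esub> Delta R A \<K> fs)"
  have "?L \<longleftrightarrow> s ` ?B = ?B"
    unfolding cohomology_class_def cohomology_def FactGroup_def coboundaries_2 r_coset_def
      UNION_singleton_eq_range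
    by (simp add: cochain_group_def s_def)
  also have "\<dots> \<longleftrightarrow> ?R"
  proof
    assume eq: "s ` ?B = ?B"
    \<comment> \<open>Zero is a coboundary, so the translating element itself lies in the
      translate.\<close>
    have "s (cobdry (\<lambda>f\<in>carrier A. \<zero>\<^bsub>M\<^esub>)) = Delta R A \<K>"
    proof (rule extensionalityI[of _ "tuples A 2"])
      fix fs assume fs: "fs \<in> tuples A 2"
      then obtain f g where "fs = [f, g]" "f \<in> carrier A" "g \<in> carrier A"
        by (auto simp: numeral_2_eq_2 tuples_2)
      with fs show "s (cobdry (\<lambda>f\<in>carrier A. \<zero>\<^bsub>M\<^esub>)) fs = Delta R A \<K> fs"
        by (simp add: s_def cobdry_def Delta_def M.minus_eq)
    qed (simp_all add: s_def Delta_def)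
    moreover have "s (cobdry (\<lambda>f\<in>carrier A. \<zero>\<^bsub>M\<^esub>)) \<in> s ` ?B"
      by (intro imageI Der_zero)
    ultimately have "Delta R A \<K> \<in> s ` ?B" by (simp only:)
    then show ?R unfolding eq by (rule imageE) (rule bexI)
  next
    assume ?R
    then obtain \<phi> where \<phi>: "\<phi> \<in> Der R A M" and eq: "Delta R A \<K> = cobdry \<phi>" by (rule bexE)
    \<comment> \<open>Closure under sums gives one inclusion; \<open>cobdry_cancel\<close> gives the
      other.\<close>
    have "s (cobdry \<psi>) \<in> ?B" if "\<psi> \<in> Der R A M" for \<psi>
      unfolding s_def eq cobdry_add[OF that \<phi>] by (intro imageI Der_add that \<phi>)
    moreover have "cobdry \<psi> \<in> s ` ?B" if \<psi>: "\<psi> \<in> Der R A M" for \<psi>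
    proof -
      from cobdry_cancel[OF \<phi> \<psi>] obtain \<chi> where \<chi>: "\<chi> \<in> Der R A M" "s (cobdry \<chi>) = cobdry \<psi>"
        unfolding s_def eq by (rule bexE)
      then show ?thesis by (metis imageI)
    qed
    ultimately show "s ` ?B = ?B" by (intro equalityI subsetI; elim imageE; simp only:)
  qed
  finally show ?thesis .
qed

text \<open>Both cochains are \<open>undefined\<close> off \<open>tuples A 2\<close>, so their
  equality is equality of values on pairs.\<close>

lemma Delta_eq_cobdry_iff:
  "Delta R A \<K> = cobdry \<phi> \<longleftrightarrow>
    (\<forall>f\<in>carrier A. \<forall>g\<in>carrier A. K f g = D f (\<phi> g) \<ominus>\<^bsub>M\<^esub> D g (\<phi> f) \<ominus>\<^bsub>M\<^esub> \<phi> (br\<^sub>0 f g))"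
proof
  assume eq: "Delta R A \<K> = cobdry \<phi>"
  show "\<forall>f\<in>carrier A. \<forall>g\<in>carrier A. K f g = D f (\<phi> g) \<ominus>\<^bsub>M\<^esub> D g (\<phi> f) \<ominus>\<^bsub>M\<^esub> \<phi> (br\<^sub>0 f g)"
  proof (intro ballI)
    fix f g assume "f \<in> carrier A" "g \<in> carrier A"
    then show "K f g = D f (\<phi> g) \<ominus>\<^bsub>M\<^esub> D g (\<phi> f) \<ominus>\<^bsub>M\<^esub> \<phi> (br\<^sub>0 f g)"
      using fun_cong[OF eq, of "[f, g]"]
      by (simp add: Delta_def cobdry_def numeral_2_eq_2 tuples_2)
  qed
next
  assume "\<forall>f\<in>carrier A. \<forall>g\<in>carrier A. K f g = D f (\<phi> g) \<ominus>\<^bsub>M\<^esub> D g (\<phi> f) \<ominus>\<^bsub>M\<^esub> \<phi> (br\<^sub>0 f g)"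
  then show "Delta R A \<K> = cobdry \<phi>"
    unfolding Delta_def cobdry_def by (intro restrict_ext) (auto simp: numeral_2_eq_2 tuples_2)
qed

section \<open>Gauge isomorphisms onto Poisson module brackets\<close>

lemma gauge_iso_D:
  assumes \<phi>: "\<phi> \<in> Der R A M" and eq: "Delta R A \<K> = cobdry \<phi>"
  shows "poisson_algebra_iso R (semidirect A M) br
    (semidirect A M) (poisson_module_bracket br\<^sub>0 M D) (gauge M \<phi>)"
proof -
  note [simp] = DerD(4)[OF \<phi>]
  \<comment> \<open>The gauge adds \<open>\<phi> (br\<^sub>0 f g)\<close> on the left, which cancels
    against the same term in \<open>K f g\<close>. What remains of \<open>K f g\<close> is the
    contribution of the shifts \<open>\<phi> f\<close> and \<open>\<phi> g\<close> on the
    right.\<close>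
  have "gauge M \<phi> (br (f, \<eta>) (g, \<xi>)) =
      poisson_module_bracket br\<^sub>0 M D (gauge M \<phi> (f, \<eta>)) (gauge M \<phi> (g, \<xi>))"
    if "f \<in> carrier A" "g \<in> carrier A" "\<eta> \<in> carrier M" "\<xi> \<in> carrier M" for f g \<eta> \<xi>
    using that eq[unfolded Delta_eq_cobdry_iff]
    by (simp add: br_pair gauge_def poisson_module_bracket_def D_add M.minus_eq M.minus_add
        M.a_ac M.r_neg M.r_neg1 M.r_neg2)
  then show ?thesis
    using gauge_ring_iso[OF \<phi>] gauge_linear[OF \<phi>] by (auto simp: poisson_algebra_iso_def)
qed

lemma Delta_eq_cobdry_if_gauge_iso:
  assumes lam: "poisson_module R A br\<^sub>0 M lam" and \<phi>: "\<phi> \<in> Der R A M"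
    and iso: "poisson_algebra_iso R (semidirect A M) br
      (semidirect A M) (poisson_module_bracket br\<^sub>0 M lam) (gauge M \<phi>)"
  shows "Delta R A \<K> = cobdry \<phi>"
  unfolding Delta_eq_cobdry_iff
proof (intro ballI)
  note [simp] = DerD(4)[OF \<phi>]
  have lam_linear: "linear_map R (restrict_scalars A M) (restrict_scalars A M) (lam f)"
    if "f \<in> carrier A" for f
    using lam that by (simp add: poisson_module_def bilinear_map_def)
  have lam_left: "linear_map R A (restrict_scalars A M) (\<lambda>f. lam f \<eta>)"
    if "\<eta> \<in> carrier M" for \<eta>
    using lam that by (simp add: poisson_module_def bilinear_map_def)
  have \<phi>0: "\<phi> \<zero>\<^bsub>A\<^esub> = \<zero>\<^bsub>M\<^esub>"
    using additive_zero[OF A.abelian_group_axioms M.abelian_group_axioms DerD(2,3)[OF \<phi>]] .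
  have lam0: "lam \<zero>\<^bsub>A\<^esub> \<eta> = \<zero>\<^bsub>M\<^esub>" if "\<eta> \<in> carrier M" for \<eta>
    using additive_zero[OF A.abelian_group_axioms M.abelian_group_axioms, of "\<lambda>f. lam f \<eta>"]
      lam_left[OF that] by (auto simp: linear_map_def)
  have lam_closed: "lam f \<eta> \<in> carrier M" if "f \<in> carrier A" "\<eta> \<in> carrier M" for f \<eta>
    using linear_map_closed[OF lam_linear] that by simp
  have hom: "gauge M \<phi> (br (f, \<eta>) (g, \<xi>)) =
      poisson_module_bracket br\<^sub>0 M lam (gauge M \<phi> (f, \<eta>)) (gauge M \<phi> (g, \<xi>))"
    if "f \<in> carrier A" "g \<in> carrier A" "\<eta> \<in> carrier M" "\<xi> \<in> carrier M" for f g \<eta> \<xi>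
    using iso that by (auto simp: poisson_algebra_iso_def)
  \<comment> \<open>The gauge fixes \<open>(0, \<xi>)\<close> because \<open>\<phi>\<close> vanishes
    at zero. It sends \<open>(f, 0)\<close> to \<open>(f, \<phi> f)\<close>, but
    \<open>\<phi> f\<close> is met only by \<open>lam\<close> at zero.\<close>
  have lam_D: "lam f \<xi> = D f \<xi>" if "f \<in> carrier A" "\<xi> \<in> carrier M" for f \<xi>
    using hom[of f "\<zero>\<^bsub>A\<^esub>" "\<zero>\<^bsub>M\<^esub>" \<xi>] that
    by (simp add: gauge_def poisson_module_bracket_def \<phi>0 lam0 lam_closed M.minus_eq)
  fix f g assume fg: "f \<in> carrier A" "g \<in> carrier A"
  \<comment> \<open>Compatibility on \<open>(f, 0)\<close> and \<open>(g, 0)\<close>, with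
    \<open>lam\<close> already replaced by \<open>D\<close>.\<close>
  have "\<phi> (br\<^sub>0 f g) \<oplus>\<^bsub>M\<^esub> K f g = D f (\<phi> g) \<ominus>\<^bsub>M\<^esub> D g (\<phi> f)"
    using hom[of f g "\<zero>\<^bsub>M\<^esub>" "\<zero>\<^bsub>M\<^esub>"] fg
    by (simp add: br_pair gauge_def poisson_module_bracket_def lam_D M.minus_eq)
  then have "\<ominus>\<^bsub>M\<^esub> \<phi> (br\<^sub>0 f g) \<oplus>\<^bsub>M\<^esub> (\<phi> (br\<^sub>0 f g) \<oplus>\<^bsub>M\<^esub> K f g) =
      D f (\<phi> g) \<ominus>\<^bsub>M\<^esub> D g (\<phi> f) \<ominus>\<^bsub>M\<^esub> \<phi> (br\<^sub>0 f g)"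
    using fg by (simp add: M.minus_eq M.a_ac)
  then show "K f g = D f (\<phi> g) \<ominus>\<^bsub>M\<^esub> D g (\<phi> f) \<ominus>\<^bsub>M\<^esub> \<phi> (br\<^sub>0 f g)"
    using fg by (simp add: M.r_neg1)
qed

end

theorem theorem9p9:
  fixes R :: "('r, 'q) ring_scheme"
    and P\<^sub>0 :: "('r, 'a, 'x) module_scheme"
    and P\<^sub>1 :: "('a, 'm, 'y) module_scheme"
    and br\<^sub>0 :: "'a \<Rightarrow> 'a \<Rightarrow> 'a"
    and br :: "'a \<times> 'm \<Rightarrow> 'a \<times> 'm \<Rightarrow> 'a \<times> 'm"
    and \<D> :: "('a \<Rightarrow> 'a) set \<Rightarrow> 'm \<Rightarrow> 'm"
    and \<K> :: "('a \<Rightarrow> 'a) set \<Rightarrow> ('a \<Rightarrow> 'a) set \<Rightarrow> 'm"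
  assumes "cring R"
    and "poisson_algebra R P\<^sub>0 br\<^sub>0"
    and "faithful_module P\<^sub>0 P\<^sub>1"
    and "admissible_poisson R P\<^sub>0 br\<^sub>0 P\<^sub>1 br"
    and "corresponding_poisson_triple R P\<^sub>0 br\<^sub>0 P\<^sub>1 br (\<lambda>\<eta> \<xi>. \<zero>\<^bsub>P\<^sub>1\<^esub>) \<D> \<K>"
  shows "(\<exists>lam. poisson_module R P\<^sub>0 br\<^sub>0 P\<^sub>1 lam \<and>
            (\<exists>\<phi>\<^sub>1\<^sub>0\<in>Der R P\<^sub>0 P\<^sub>1.
               poisson_algebra_iso R (semidirect P\<^sub>0 P\<^sub>1) br
                 (semidirect P\<^sub>0 P\<^sub>1) (poisson_module_bracket br\<^sub>0 P\<^sub>1 lam) (gauge P\<^sub>1 \<phi>\<^sub>1\<^sub>0)))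
         \<longleftrightarrow> cohomology_class R P\<^sub>0 br\<^sub>0 P\<^sub>1 \<D> 2 (Delta R P\<^sub>0 \<K>) = \<one>\<^bsub>cohomology R P\<^sub>0 br\<^sub>0 P\<^sub>1 \<D> 2\<^esub>"
proof -
  interpret abelian_poisson_triple R P\<^sub>0 P\<^sub>1 br\<^sub>0 br \<D> \<K>
    using assms by (intro abelian_poisson_triple.intro) (simp_all add: faithful_module_def)
  show ?thesis
    \<comment> \<open>The same derivation serves both sides: \<open>D\<close> is the witness for
      \<open>lam\<close> when \<open>Delta R P\<^sub>0 \<K>\<close> is a coboundary, and conversely
      any \<open>lam\<close> yields the coboundary equation.\<close>
    unfolding class_trivial_iff
    using poisson_module_D gauge_iso_D Delta_eq_cobdry_if_gauge_iso by blast
qed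

end
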